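(* Let $q:\Theta\to[0,\infty)$ be integrable with normalizing constant $c_q=\int_\Theta q\,d\nu>0$, let $q_\ast=q/c_q$, and for $\epsilon\in[0,1]$ consider the linearly contaminated prior density $$\pi_\epsilon(\theta)=\frac{1-\epsilon}{1-\epsilon+\epsilon c_q}\pi(\theta)+\frac{\epsilon c_q}{1-\epsilon+\epsilon c_q}q_\ast(\theta).$$ Let $\theta\in\Theta$ be a point with $0<\Pi(\{\theta\})=\pi(\theta)<1$. Let $RB_\epsilon(\theta\,|\,T(x))=f_{\theta,T}(T(x))/m_{T,\epsilon}(T(x))$ be the relative belief ratio and $$BF_\epsilon(\theta\,|\,T(x))=\frac{(1-\pi_\epsilon(\theta))RB_\epsilon(\theta\,|\,T(x))}{1-\pi_\epsilon(\theta)RB_\epsilon(\theta\,|\,T(x))}$$ the Bayes factor at $\theta$ based on the prior $\pi_\epsilon$, and let $BF(\theta\,|\,x)=BF_0(\theta\,|\,T(x))$. Then $$\left.\frac{\partial\log BF_\epsilon(\theta\,|\,T(x))}{\partial\epsilon}\right\vert_{\epsilon=0}=\left.\frac{\partial\log RB_\epsilon(\theta\,|\,T(x))}{\partial\epsilon}\right\vert_{\epsilon=0}\left(1+\frac{\pi(\theta)}{1-\pi(\theta)}BF(\theta\,|\,x)\right)+c_q\left(\frac{\pi(\theta)-q_\ast(\theta)}{1-\pi(\theta)}\right)(1-BF(\theta\,|\,x)).$$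
   Context: Setting: $T$ is a minimal sufficient statistic, with values in $\mathcal T$, for a statistical model with parameter space $\Theta$; $f_{\theta,T}$ is the sampling density of $T$ under $\theta$ with respect to a support measure on $\mathcal T$; $x$ is the observed data. The prior $\Pi$ has density $\pi$ with respect to a support measure $\nu$ on $\Theta$ (counting measure in the discrete case) with $\nu(\{\theta\})=1$ at the point $\theta$ considered, so $\pi(\theta)$, $q_\ast(\theta)$ and $\pi_\epsilon(\theta)$ are the probabilities of $\{\theta\}$ under the respective priors. The prior predictive density of $T$ under prior density $\pi_\epsilon$ is $m_{T,\epsilon}(t)=\int_\Theta f_{\theta,T}(t)\pi_\epsilon(\theta)\,\nu(d\theta)$. It is assumed that $f_{\theta,T}(T(x))>0$ at the point $\theta$ considered, that the prior predictive densities at $T(x)$ under $\pi$ and $q_\ast$ are finite, and that the posterior probability $\pi(\theta)RB_0(\theta\,|\,T(x))$ of $\{\theta\}$ under $\pi$ is less than $1$, so that all quantities are defined. Derivatives at $\epsilon=0$ are right-hand derivatives. *)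

theory Defs
  imports "HOL-Probability.Probability"
begin

text \<open>
  A statistical model is a family \<open>P\<close> of probability measures on the sample space \<open>X\<close>, indexed by
  a set \<open>\<Theta>\<close>. A statistic is sufficient if, for every event, one version of its conditional
  probability given the statistic serves all parameter values at once.
\<close>

definition sufficient_statistic ::
    "'p set \<Rightarrow> 'x measure \<Rightarrow> ('p \<Rightarrow> 'x measure) \<Rightarrow> 's measure \<Rightarrow> ('x \<Rightarrow> 's) \<Rightarrow> bool" where
  "sufficient_statistic \<Theta> X P N S \<longleftrightarrow>
     S \<in> measurable X N \<and>
     (\<forall>A\<in>sets X. \<exists>g\<in>borel_measurable N. \<forall>\<theta>\<in>\<Theta>. AE x in P \<theta>.
        real_cond_exp (P \<theta>) (vimage_algebra (space X) S N) (indicator A) x = g (S x))"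

text \<open>
  A sufficient statistic is minimal if it is (almost surely) a function of every sufficient
  statistic. HOL cannot quantify over the value type of the competing statistic \<open>S\<close>; nothing is
  lost by letting it range over \<open>'x\<close>-valued statistics, because the range of a statistic on \<open>X\<close>
  injects into \<open>'x\<close> (choose a point in each fibre) and its \<sigma>-algebra can be carried along.
\<close>

definition minimal_sufficient_statistic ::
    "'p set \<Rightarrow> 'x measure \<Rightarrow> ('p \<Rightarrow> 'x measure) \<Rightarrow> 't measure \<Rightarrow> ('x \<Rightarrow> 't) \<Rightarrow> bool" where
  "minimal_sufficient_statistic \<Theta> X P M T \<longleftrightarrow>
     sufficient_statistic \<Theta> X P M T \<and>
     (\<forall>(N :: 'x measure) (S :: 'x \<Rightarrow> 'x). sufficient_statistic \<Theta> X P N S \<longrightarrow>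
        (\<exists>H. \<forall>\<theta>\<in>\<Theta>. AE x in P \<theta>. T x = H (S x)))"

definition norm_const :: "'p measure \<Rightarrow> ('p \<Rightarrow> real) \<Rightarrow> real" where
  "norm_const \<nu> q = (\<integral>\<theta>. q \<theta> \<partial>\<nu>)"

definition normalized :: "'p measure \<Rightarrow> ('p \<Rightarrow> real) \<Rightarrow> 'p \<Rightarrow> real" where
  "normalized \<nu> q \<theta> = q \<theta> / norm_const \<nu> q"

definition contaminated_prior ::
    "'p measure \<Rightarrow> ('p \<Rightarrow> real) \<Rightarrow> ('p \<Rightarrow> real) \<Rightarrow> real \<Rightarrow> 'p \<Rightarrow> real" where
  "contaminated_prior \<nu> \<pi> q \<epsilon> \<theta> =
     (1 - \<epsilon>) / (1 - \<epsilon> + \<epsilon> * norm_const \<nu> q) * \<pi> \<theta> +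
     \<epsilon> * norm_const \<nu> q / (1 - \<epsilon> + \<epsilon> * norm_const \<nu> q) * normalized \<nu> q \<theta>"

text \<open>In what follows \<open>f \<theta> t\<close> is a sampling density and \<open>p\<close> a prior density with respect to \<open>\<nu>\<close>.\<close>

definition prior_predictive ::
    "'p measure \<Rightarrow> ('p \<Rightarrow> 't \<Rightarrow> real) \<Rightarrow> ('p \<Rightarrow> real) \<Rightarrow> 't \<Rightarrow> real" where
  "prior_predictive \<nu> f p t = (\<integral>\<theta>. f \<theta> t * p \<theta> \<partial>\<nu>)"

definition relative_belief ::
    "'p measure \<Rightarrow> ('p \<Rightarrow> 't \<Rightarrow> real) \<Rightarrow> ('p \<Rightarrow> real) \<Rightarrow> 'p \<Rightarrow> 't \<Rightarrow> real" where
  "relative_belief \<nu> f p \<theta> t = f \<theta> t / prior_predictive \<nu> f p t"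

text \<open>Prior and posterior odds of the singleton \<open>{\<theta>}\<close> enter through \<open>p \<theta>\<close>, which is its prior
  probability when \<open>\<nu> {\<theta>} = 1\<close>.\<close>

definition bayes_factor ::
    "'p measure \<Rightarrow> ('p \<Rightarrow> 't \<Rightarrow> real) \<Rightarrow> ('p \<Rightarrow> real) \<Rightarrow> 'p \<Rightarrow> 't \<Rightarrow> real" where
  "bayes_factor \<nu> f p \<theta> t =
     (1 - p \<theta>) * relative_belief \<nu> f p \<theta> t / (1 - p \<theta> * relative_belief \<nu> f p \<theta> t)"

end

theory Submission
  imports Defs
begin

text \<open>
  Write \<open>p\<close> for the prior probability of the point and \<open>r\<close> for its relative belief ratio, both as
  functions of \<open>\<epsilon>\<close>. Logarithmic differentiation of \<open>BF = (1 - p) r / (1 - p r)\<close> gives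
  \<open>(ln BF)' = (ln r)' / (1 - p r) + p' (r / (1 - p r) - 1 / (1 - p))\<close>, where
  \<open>1 / (1 - p r) = 1 + p / (1 - p) BF\<close> and the second bracket equals \<open>(BF - 1) / (1 - p)\<close>.
  For linear contamination \<open>p' = c\<^sub>q (q\<^sub>* - \<pi>)\<close> at \<open>\<epsilon> = 0\<close>, whatever the prior predictive does.
\<close>

lemma has_real_derivative_ln_bayes_factor:
  fixes p r :: "real \<Rightarrow> real"
  assumes p: "(p has_real_derivative p') (at a within S)"
    and r: "(r has_real_derivative r') (at a within S)"
    and "0 < r a" "p a < 1" "p a * r a < 1"
  shows "((\<lambda>\<epsilon>. ln ((1 - p \<epsilon>) * r \<epsilon> / (1 - p \<epsilon> * r \<epsilon>))) has_real_derivative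
    r' / r a * (1 + p a / (1 - p a) * ((1 - p a) * r a / (1 - p a * r a)))
      - p' / (1 - p a) * (1 - (1 - p a) * r a / (1 - p a * r a))) (at a within S)"
proof -
  have nz: "1 - p a \<noteq> 0" "r a \<noteq> 0" "1 - p a * r a \<noteq> 0"
    and pos: "0 < (1 - p a) * r a / (1 - p a * r a)"
    using assms by auto
  show ?thesis
    \<comment> \<open>\<open>pos\<close> permits differentiating \<open>ln\<close>; after the chain
      and quotient rules a rational identity remains, cleared by the nonzero denominators in
      \<open>nz\<close>.\<close>
    by (rule derivative_eq_intros p r pos nz refl)+ (use nz in \<open>simp add: divide_simps, algebra\<close>)
qed

text \<open>Linearity of the integral in the prior density. The mixture weights carry over, so as a
  function of \<epsilon> the prior predictive has the same form as the prior mass of a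
  point.\<close>

lemma prior_predictive_contaminated_prior:
  assumes "integrable \<nu> (\<lambda>\<theta>. f \<theta> t * \<pi> \<theta>)"
    and "integrable \<nu> (\<lambda>\<theta>. f \<theta> t * normalized \<nu> q \<theta>)"
  shows "prior_predictive \<nu> f (contaminated_prior \<nu> \<pi> q \<epsilon>) t =
    (1 - \<epsilon>) / (1 - \<epsilon> + \<epsilon> * norm_const \<nu> q) * prior_predictive \<nu> f \<pi> t +
    \<epsilon> * norm_const \<nu> q / (1 - \<epsilon> + \<epsilon> * norm_const \<nu> q) *
      prior_predictive \<nu> f (normalized \<nu> q) t"
    (is "_ = ?a * _ + ?b * _")
proof -
  have "prior_predictive \<nu> f (contaminated_prior \<nu> \<pi> q \<epsilon>) t =
      (\<integral>\<theta>. ?a * (f \<theta> t * \<pi> \<theta>) + ?b * (f \<theta> t * normalized \<nu> q \<theta>) \<partial>\<nu>)"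
    unfolding prior_predictive_def contaminated_prior_def
    by (intro Bochner_Integration.integral_cong refl) (simp only: distrib_left mult.left_commute)
  then show ?thesis
    using assms unfolding prior_predictive_def
    by (simp only: Bochner_Integration.integral_add integrable_mult_right
        integral_mult_right_zero)
qed

text \<open>At 0 the denominator is 1 and the two weights have derivatives \<open>-c\<close> and
  \<open>c\<close>. With \<open>a\<close> and \<open>b\<close> arbitrary, this covers both the prior
  mass at \<theta> and the prior predictive.\<close>

lemma contamination_has_real_derivative:
  fixes a b c :: real
  shows "((\<lambda>\<epsilon>. (1 - \<epsilon>) / (1 - \<epsilon> + \<epsilon> * c) * a + \<epsilon> * c / (1 - \<epsilon> + \<epsilon> * c) * b)
    has_real_derivative c * (b - a)) (at 0 within S)"
  by (auto intro!: derivative_eq_intros simp: algebra_simps)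

text \<open>Restricting a nonnegative integrand to an atom of mass 1 leaves exactly its value there.
  This serves to bound the prior predictive away from 0.\<close>

lemma integral_ge_atom:
  fixes g :: "'a \<Rightarrow> real"
  assumes "integrable M g" "\<And>y. y \<in> space M \<Longrightarrow> 0 \<le> g y" "emeasure M {y} = 1"
  shows "g y \<le> (\<integral>y. g y \<partial>M)"
proof -
  \<comment> \<open>\<open>emeasure\<close> is 0 by convention on nonmeasurable sets, so mass 1
    forces measurability.\<close>
  have sets: "{y} \<in> sets M"
    using assms(3) by (metis emeasure_notin_sets zero_neq_one)
  have "(\<integral>z. indicator {y} z * g z \<partial>M) = (\<integral>z. g y * indicator {y} z \<partial>M)"
    by (intro Bochner_Integration.integral_cong) (auto simp: indicator_def)
  also have "\<dots> = g y"
    using sets assms(3) by (simp add: measure_def sets.sets_into_space Int_absorb2)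
  finally have "(\<integral>z. indicator {y} z * g z \<partial>M) = g y" .
  moreover have "(\<integral>z. indicator {y} z * g z \<partial>M) \<le> (\<integral>z. g z \<partial>M)"
    using integrable_mult_indicator[OF sets assms(1)] assms(1,2)
    by (intro integral_mono) (auto simp: indicator_def)
  ultimately show ?thesis by simp
qed

text \<open>This turns the hypotheses on the prior probability of \<open>{\<theta>}\<close> into
  bounds on the density value \<open>\<pi> \<theta>\<close>.\<close>

lemma measure_density_atom:
  assumes "g \<in> borel_measurable M" "0 \<le> g y" "emeasure M {y} = 1"
  shows "measure (density M (\<lambda>y. ennreal (g y))) {y} = g y"
proof -
  have sets: "{y} \<in> sets M"
    using assms(3) by (metis emeasure_notin_sets zero_neq_one)
  have "emeasure (density M (\<lambda>y. ennreal (g y))) {y} =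
      (\<integral>\<^sup>+ z. ennreal (g z) * indicator {y} z \<partial>M)"
    using sets assms(1) by (simp add: emeasure_density)
  also have "\<dots> = ennreal (g y)"
    using sets assms(3) by (simp add: nn_integral_indicator_singleton)
  finally show ?thesis
    using assms(2) by (simp add: measure_def)
qed

theorem proposition7:
  fixes X :: "'x measure" and P :: "'p \<Rightarrow> 'x measure"
    and \<mu> :: "'t measure" and T :: "'x \<Rightarrow> 't" and f :: "'p \<Rightarrow> 't \<Rightarrow> real"
    and \<nu> prior :: "'p measure" and \<pi> q :: "'p \<Rightarrow> real"
    and x :: 'x and \<theta> :: 'p
  defines "RB \<equiv> \<lambda>\<epsilon>. relative_belief \<nu> f (contaminated_prior \<nu> \<pi> q \<epsilon>) \<theta> (T x)"
    and "BF \<equiv> \<lambda>\<epsilon>. bayes_factor \<nu> f (contaminated_prior \<nu> \<pi> q \<epsilon>) \<theta> (T x)"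
  assumes model: "\<And>\<theta>. \<theta> \<in> space \<nu> \<Longrightarrow> P \<theta> \<in> space (prob_algebra X)"
    and T: "minimal_sufficient_statistic (space \<nu>) X P \<mu> T"
    and f_density: "\<And>\<theta>. \<theta> \<in> space \<nu> \<Longrightarrow> distributed (P \<theta>) \<mu> T (\<lambda>t. ennreal (f \<theta> t))"
    and f_nonneg: "\<And>\<theta> t. \<theta> \<in> space \<nu> \<Longrightarrow> t \<in> space \<mu> \<Longrightarrow> 0 \<le> f \<theta> t"
    and x: "x \<in> space X"
    and prior_density: "prob_space prior" "prior = density \<nu> (\<lambda>\<theta>. ennreal (\<pi> \<theta>))"
    and \<pi>: "\<pi> \<in> borel_measurable \<nu>" "\<And>\<theta>. \<theta> \<in> space \<nu> \<Longrightarrow> 0 \<le> \<pi> \<theta>"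
    and q: "integrable \<nu> q" "\<And>\<theta>. \<theta> \<in> space \<nu> \<Longrightarrow> 0 \<le> q \<theta>" "norm_const \<nu> q > 0"
    and \<theta>: "\<theta> \<in> space \<nu>" "emeasure \<nu> {\<theta>} = 1"
    and prior_\<theta>: "0 < measure prior {\<theta>}" "measure prior {\<theta>} < 1"
    and f_pos: "f \<theta> (T x) > 0"
    and predictive_finite: "integrable \<nu> (\<lambda>\<theta>. f \<theta> (T x) * \<pi> \<theta>)"
      "integrable \<nu> (\<lambda>\<theta>. f \<theta> (T x) * normalized \<nu> q \<theta>)"
    and posterior_\<theta>: "\<pi> \<theta> * RB 0 < 1"
  shows "\<exists>D\<^sub>R\<^sub>B D\<^sub>B\<^sub>F.
    ((\<lambda>\<epsilon>. ln (RB \<epsilon>)) has_real_derivative D\<^sub>R\<^sub>B) (at_right 0) \<and>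
    ((\<lambda>\<epsilon>. ln (BF \<epsilon>)) has_real_derivative D\<^sub>B\<^sub>F) (at_right 0) \<and>
    D\<^sub>B\<^sub>F = D\<^sub>R\<^sub>B * (1 + \<pi> \<theta> / (1 - \<pi> \<theta>) * BF 0)
         + norm_const \<nu> q * ((\<pi> \<theta> - normalized \<nu> q \<theta>) / (1 - \<pi> \<theta>)) * (1 - BF 0)"
proof -
  let ?p = "\<lambda>\<epsilon>. contaminated_prior \<nu> \<pi> q \<epsilon> \<theta>"
  define m where "m = (\<lambda>\<epsilon>. prior_predictive \<nu> f (contaminated_prior \<nu> \<pi> q \<epsilon>) (T x))"
  have p0: "contaminated_prior \<nu> \<pi> q 0 = \<pi>"
    by (simp add: contaminated_prior_def fun_eq_iff)
  have \<pi>_bounds: "0 < \<pi> \<theta>" "\<pi> \<theta> < 1"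
    using measure_density_atom[OF \<pi>(1) \<pi>(2)[OF \<theta>(1)] \<theta>(2)] prior_\<theta> prior_density(2) by auto
  \<comment> \<open>Nonnegativity of \<open>f\<close> is assumed only over
    \<open>space \<mu>\<close>, so the observed value \<open>T x\<close> must be located
    there.\<close>
  have "T \<in> measurable (P \<theta>) \<mu>"
    using f_density[OF \<theta>(1)] by (simp add: distributed_def)
  moreover have "space (P \<theta>) = space X"
    using model[OF \<theta>(1)] by (intro sets_eq_imp_space_eq) (simp add: space_prob_algebra)
  ultimately have Tx: "T x \<in> space \<mu>"
    using x by (auto dest: measurable_space)
  \<comment> \<open>The atom at \<theta> alone makes the prior predictive positive, so
    \<open>RB 0\<close> is a genuine positive quotient.\<close>
  have "0 < f \<theta> (T x) * \<pi> \<theta>"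
    using f_pos \<pi>_bounds by simp
  also have "\<dots> \<le> m 0"
    unfolding m_def p0 prior_predictive_def
    using f_nonneg[OF _ Tx] \<pi>(2) by (intro integral_ge_atom predictive_finite \<theta>) auto
  finally have m0: "0 < m 0" .
  \<comment> \<open>Only existence matters: the claim relates the two logarithmic derivatives, so
    the value of \<open>m'\<close> stays hidden inside \<open>R'\<close>.\<close>
  obtain m' where m': "(m has_real_derivative m') (at_right 0)"
    using contamination_has_real_derivative
    unfolding m_def prior_predictive_contaminated_prior[where f = f, OF predictive_finite]
    by blast
  have p': "(?p has_real_derivative norm_const \<nu> q * (normalized \<nu> q \<theta> - \<pi> \<theta>)) (at_right 0)"
    unfolding contaminated_prior_def by (rule contamination_has_real_derivative)
  have RB: "RB = (\<lambda>\<epsilon>. f \<theta> (T x) / m \<epsilon>)"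
    by (simp add: RB_def relative_belief_def m_def)
  have BF: "BF = (\<lambda>\<epsilon>. (1 - ?p \<epsilon>) * RB \<epsilon> / (1 - ?p \<epsilon> * RB \<epsilon>))"
    by (simp add: BF_def RB_def bayes_factor_def)
  have RB0: "0 < RB 0"
    using m0 f_pos by (simp add: RB)
  obtain R' where R': "(RB has_real_derivative R') (at_right 0)"
    using DERIV_divide[OF DERIV_const m', of "f \<theta> (T x)"] m0 by (fold RB) auto
  have "((\<lambda>\<epsilon>. ln (RB \<epsilon>)) has_real_derivative R' / RB 0) (at_right 0)"
    using R' RB0 by (auto intro!: derivative_eq_intros)
  moreover have "((\<lambda>\<epsilon>. ln (BF \<epsilon>)) has_real_derivative
      R' / RB 0 * (1 + \<pi> \<theta> / (1 - \<pi> \<theta>) * BF 0)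
      - norm_const \<nu> q * (normalized \<nu> q \<theta> - \<pi> \<theta>) / (1 - \<pi> \<theta>) * (1 - BF 0)) (at_right 0)"
    using has_real_derivative_ln_bayes_factor[OF p' R'] RB0 \<pi>_bounds posterior_\<theta>
    by (simp add: BF p0)
  \<comment> \<open>The general formula subtracts a multiple of the derivative of the prior mass;
    reversing the difference gives the added term of the claim.\<close>
  moreover have "norm_const \<nu> q * (normalized \<nu> q \<theta> - \<pi> \<theta>) / (1 - \<pi> \<theta>) =
      - (norm_const \<nu> q * ((\<pi> \<theta> - normalized \<nu> q \<theta>) / (1 - \<pi> \<theta>)))"
    by (simp add: minus_divide_left algebra_simps)
  ultimately show ?thesis
    by (intro exI conjI) auto
qed

end
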